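(* The variety of all Sheffer groupoids $(A,|)$ satisfying the identities $$(x|y)|(x|x)\approx(x|x)|(x|y),\qquad (x|y)|(y|y)\approx(y|y)|(x|y)$$ is congruence distributive, i.e. every member of this variety has a distributive congruence lattice.
   Context: A Sheffer groupoid is a pair $(A,|)$ where $A$ is a non-empty set and $|$ is a binary operation on $A$ satisfying the identities $(x|y)|(x|x)\approx x$ and $(x|y)|(y|y)\approx y$. Here $s\approx t$ means that $s=t$ holds for all values of the variables in $A$. *)

theory Defs
  imports "HOL-Algebra.Lattice"
begin

locale groupoid =
  fixes A :: "'a set" and op :: "'a \<Rightarrow> 'a \<Rightarrow> 'a" (infixl \<open>\<parallel>\<close> 70)
  assumes nonempty: "A \<noteq> {}"
    and closed: "x \<in> A \<Longrightarrow> y \<in> A \<Longrightarrow> x \<parallel> y \<in> A"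

locale sheffer_groupoid = groupoid +
  assumes sheffer_left: "x \<in> A \<Longrightarrow> y \<in> A \<Longrightarrow> (x \<parallel> y) \<parallel> (x \<parallel> x) = x"
    and sheffer_right: "x \<in> A \<Longrightarrow> y \<in> A \<Longrightarrow> (x \<parallel> y) \<parallel> (y \<parallel> y) = y"

definition congruences :: "'a set \<Rightarrow> ('a \<Rightarrow> 'a \<Rightarrow> 'a) \<Rightarrow> ('a \<times> 'a) set set"
  where "congruences A f =
    {r. equiv A r \<and> (\<forall>(x, x') \<in> r. \<forall>(y, y') \<in> r. (f x y, f x' y') \<in> r)}"

definition congruence_lattice :: "'a set \<Rightarrow> ('a \<Rightarrow> 'a \<Rightarrow> 'a) \<Rightarrow> ('a \<times> 'a) set gorder"
  where "congruence_lattice A f = \<lparr>carrier = congruences A f, eq = (=), le = (\<subseteq>)\<rparr>"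

locale distributive_lattice = lattice +
  assumes meet_join_distrib:
    "\<lbrakk>x \<in> carrier L; y \<in> carrier L; z \<in> carrier L\<rbrakk>
      \<Longrightarrow> x \<sqinter> (y \<squnion> z) = (x \<sqinter> y) \<squnion> (x \<sqinter> z)"

text \<open>
  The property of a single algebra; a variety is congruence distributive if and only if
  each of its members has it.
\<close>

definition congruence_distributive :: "'a set \<Rightarrow> ('a \<Rightarrow> 'a \<Rightarrow> 'a) \<Rightarrow> bool"
  where "congruence_distributive A f \<longleftrightarrow> distributive_lattice (congruence_lattice A f)"

end

theory Submission
  imports Defs
begin

text \<open>
  Write \<open>x' = x | x\<close>, \<open>m x y = (x | y)'\<close> and \<open>j x y = x' | y'\<close>. The Sheffer identities give
  \<open>x'' = x\<close>, so \<open>j x x = x\<close>, and together with the two extra identities they say that \<open>m\<close>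
  absorbs \<open>j\<close> on both sides and in both arguments:
  \<open>m x (j x y) = m x (j y x) = m (j x y) x = m (j y x) x = x\<close>.
  These laws make
  \<open>x, m x (j z y), m x z, m (j x y) z, z\<close>
  a sequence of Jonsson terms in the variables \<open>x, y, z\<close>:
  each of them becomes \<open>x\<close> for \<open>z = x\<close>, and consecutive ones agree alternately for \<open>y = x\<close>
  and for \<open>y = z\<close>.

  Suppose now that \<open>(a, c)\<close> lies in a congruence \<open>\<alpha>\<close> and in the join of \<open>\<beta>\<close> and \<open>\<gamma>\<close>. Then a chain
  of \<open>\<beta>\<close>- and \<open>\<gamma>\<close>-steps leads from \<open>a\<close> to \<open>c\<close>. Putting \<open>x = a\<close> and \<open>z = c\<close> and moving \<open>y\<close> along this
  chain, each term takes values that are all \<open>\<alpha>\<close>-related to \<open>a\<close>, so every step of the image of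
  the chain lies in \<open>\<alpha> \<inter> \<beta>\<close> or in \<open>\<alpha> \<inter> \<gamma>\<close> (\<open>trancl_Un_image_Int\<close>). The images under the two
  terms that involve \<open>y\<close> join up at \<open>m a c\<close> to a path from \<open>a\<close> to \<open>c\<close>
  (\<open>congruence_distributive_if_absorption\<close>).
\<close>

section \<open>The lattice of congruences\<close>

lemma congruenceD:
  assumes "r \<in> congruences A f"
  shows "equiv A r"
    and "\<lbrakk>(x, x') \<in> r; (y, y') \<in> r\<rbrakk> \<Longrightarrow> (f x y, f x' y') \<in> r"
  using assms unfolding congruences_def by blast+

lemma Int_congruence:
  assumes "\<beta> \<in> congruences A f" "\<gamma> \<in> congruences A f"
  shows "\<beta> \<inter> \<gamma> \<in> congruences A f"
proof -
  have "equiv A (\<beta> \<inter> \<gamma>)"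
    using congruenceD(1)[OF assms(1)] congruenceD(1)[OF assms(2)]
    unfolding equiv_def refl_on_def by (auto intro: sym_Int trans_Int)
  then show ?thesis
    using congruenceD(2)[OF assms(1)] congruenceD(2)[OF assms(2)]
    unfolding congruences_def by auto
qed

lemma trancl_Un_congruence:
  assumes \<beta>: "\<beta> \<in> congruences A f" and \<gamma>: "\<gamma> \<in> congruences A f"
  shows "(\<beta> \<union> \<gamma>)\<^sup>+ \<in> congruences A f"
proof -
  let ?R = "(\<beta> \<union> \<gamma>)\<^sup>+"
  note eq = congruenceD(1)[OF \<beta>] congruenceD(1)[OF \<gamma>]
  have sub: "?R \<subseteq> A \<times> A"
    using eq by (intro trancl_subset_Sigma) (auto simp: equiv_def)
  have refl: "(x, x) \<in> \<beta> \<union> \<gamma>" if "x \<in> A" for x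
    using eq that by (auto simp: equiv_def refl_on_def)
  have "equiv A ?R"
  proof (rule equivI[OF sub])
    show "refl_on A ?R"
      using refl by (auto simp: refl_on_def)
    show "sym ?R"
      using eq by (auto simp: equiv_def intro: sym_trancl sym_Un)
  qed (rule trans_trancl)
  \<comment> \<open>A chain can be moved through one argument at a time; doing both arguments at once
    would need two chains of equal shape.\<close>
  moreover have left: "(f x y, f x' y) \<in> ?R" if "(x, x') \<in> ?R" "y \<in> A" for x x' y
  proof -
    have step: "(f u y, f v y) \<in> ?R" if "(u, v) \<in> \<beta> \<union> \<gamma>" for u v
      using that \<open>y \<in> A\<close> eq congruenceD(2)[OF \<beta>] congruenceD(2)[OF \<gamma>]
      by (auto simp: equiv_def refl_on_def intro!: r_into_trancl)
    show ?thesis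
      using that(1) by (induction rule: trancl_induct) (auto intro: step trancl_trans)
  qed
  moreover have right: "(f x y, f x y') \<in> ?R" if "(y, y') \<in> ?R" "x \<in> A" for x y y'
  proof -
    have step: "(f x u, f x v) \<in> ?R" if "(u, v) \<in> \<beta> \<union> \<gamma>" for u v
      using that \<open>x \<in> A\<close> eq congruenceD(2)[OF \<beta>] congruenceD(2)[OF \<gamma>]
      by (auto simp: equiv_def refl_on_def intro!: r_into_trancl)
    show ?thesis
      using that(1) by (induction rule: trancl_induct) (auto intro: step trancl_trans)
  qed
  moreover have "(f x y, f x' y') \<in> ?R" if "(x, x') \<in> ?R" "(y, y') \<in> ?R" for x x' y y'
  proof (rule trancl_trans)
    show "(f x y, f x' y) \<in> ?R" using left that sub by blast
    show "(f x' y, f x' y') \<in> ?R" using right that sub by blast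
  qed
  ultimately show ?thesis
    unfolding congruences_def by blast
qed

lemma partial_order_congruence_lattice:
  "partial_order (congruence_lattice A f)"
  by unfold_locales (auto simp: congruence_lattice_def)

lemma least_trancl_Un:
  assumes "\<beta> \<in> congruences A f" "\<gamma> \<in> congruences A f"
  shows "least (congruence_lattice A f) ((\<beta> \<union> \<gamma>)\<^sup>+) (Upper (congruence_lattice A f) {\<beta>, \<gamma>})"
proof (rule least_UpperI)
  fix \<delta> assume "\<delta> \<in> Upper (congruence_lattice A f) {\<beta>, \<gamma>}"
  then have "\<beta> \<union> \<gamma> \<subseteq> \<delta>" and "trans \<delta>"
    using assms by (auto simp: Upper_def congruence_lattice_def congruences_def equiv_def)
  then have "(\<beta> \<union> \<gamma>)\<^sup>+ \<subseteq> \<delta>"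
    by (metis trancl_id trancl_mono subsetI)
  then show "(\<beta> \<union> \<gamma>)\<^sup>+ \<sqsubseteq>\<^bsub>congruence_lattice A f\<^esub> \<delta>"
    by (simp add: congruence_lattice_def)
qed (use assms in \<open>auto simp: congruence_lattice_def intro: trancl_Un_congruence\<close>)

lemma greatest_Int:
  assumes "\<beta> \<in> congruences A f" "\<gamma> \<in> congruences A f"
  shows "greatest (congruence_lattice A f) (\<beta> \<inter> \<gamma>) (Lower (congruence_lattice A f) {\<beta>, \<gamma>})"
  using assms Int_congruence[OF assms]
  by (intro greatest_LowerI) (auto simp: congruence_lattice_def Lower_def)

lemma lattice_congruence_lattice: "lattice (congruence_lattice A f)"
proof -
  interpret partial_order "congruence_lattice A f"
    by (rule partial_order_congruence_lattice)
  have carrier: "carrier (congruence_lattice A f) = congruences A f"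
    by (simp add: congruence_lattice_def)
  show ?thesis
    by unfold_locales (auto simp: carrier intro: least_trancl_Un greatest_Int)
qed

lemma join_congruence_lattice:
  assumes "\<beta> \<in> congruences A f" "\<gamma> \<in> congruences A f"
  shows "\<beta> \<squnion>\<^bsub>congruence_lattice A f\<^esub> \<gamma> = (\<beta> \<union> \<gamma>)\<^sup>+"
  unfolding join_def sup_def
  by (rule some_equality)
    (rule least_trancl_Un[OF assms],
      rule partial_order.least_unique[OF partial_order_congruence_lattice _ least_trancl_Un[OF assms]])

lemma meet_congruence_lattice:
  assumes "\<beta> \<in> congruences A f" "\<gamma> \<in> congruences A f"
  shows "\<beta> \<sqinter>\<^bsub>congruence_lattice A f\<^esub> \<gamma> = \<beta> \<inter> \<gamma>"
  unfolding meet_def inf_def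
  by (rule some_equality)
    (rule greatest_Int[OF assms],
      rule partial_order.greatest_unique[OF partial_order_congruence_lattice _ greatest_Int[OF assms]])

text \<open>
  One inclusion of the distributive law holds in every lattice, so only elements of
  \<open>\<alpha> \<inter> (\<beta> \<union> \<gamma>)\<^sup>+\<close> have to be looked at.
\<close>

lemma congruence_distributiveI:
  assumes "\<And>\<alpha> \<beta> \<gamma>.
    \<lbrakk>\<alpha> \<in> congruences A f; \<beta> \<in> congruences A f; \<gamma> \<in> congruences A f\<rbrakk>
      \<Longrightarrow> \<alpha> \<inter> (\<beta> \<union> \<gamma>)\<^sup>+ \<subseteq> (\<alpha> \<inter> \<beta> \<union> \<alpha> \<inter> \<gamma>)\<^sup>+"
  shows "congruence_distributive A f"
proof -
  interpret lattice "congruence_lattice A f"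
    by (rule lattice_congruence_lattice)
  have carrier: "carrier (congruence_lattice A f) = congruences A f"
    by (simp add: congruence_lattice_def)
  show ?thesis
    unfolding congruence_distributive_def
  proof (unfold_locales, unfold carrier)
    fix \<alpha> \<beta> \<gamma>
    assume C: "\<alpha> \<in> congruences A f" "\<beta> \<in> congruences A f" "\<gamma> \<in> congruences A f"
    have "trans \<alpha>"
      using congruenceD(1)[OF C(1)] by (simp add: equiv_def)
    then have "(\<alpha> \<inter> \<beta> \<union> \<alpha> \<inter> \<gamma>)\<^sup>+ \<subseteq> \<alpha>"
      by (metis Int_Un_distrib inf_le1 trancl_id trancl_mono subsetI)
    moreover have "(\<alpha> \<inter> \<beta> \<union> \<alpha> \<inter> \<gamma>)\<^sup>+ \<subseteq> (\<beta> \<union> \<gamma>)\<^sup>+"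
      by (auto elim!: trancl_mono)
    ultimately show "\<alpha> \<sqinter>\<^bsub>congruence_lattice A f\<^esub> (\<beta> \<squnion>\<^bsub>congruence_lattice A f\<^esub> \<gamma>)
        = (\<alpha> \<sqinter>\<^bsub>congruence_lattice A f\<^esub> \<beta>) \<squnion>\<^bsub>congruence_lattice A f\<^esub>
          (\<alpha> \<sqinter>\<^bsub>congruence_lattice A f\<^esub> \<gamma>)"
      using assms[OF C]
      by (simp add: C join_congruence_lattice meet_congruence_lattice
          trancl_Un_congruence Int_congruence subset_antisym)
  qed
qed

section \<open>Absorption laws imply congruence distributivity\<close>

text \<open>
  The inductive core of Jonsson's argument. In the application \<open>q u\<close> is a ternary term with its
  outer arguments fixed to an \<open>\<alpha>\<close>-related pair \<open>(e, c)\<close>; up to \<open>\<alpha>\<close> one may replace \<open>c\<close> by \<open>e\<close>,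
  and then the term has the value \<open>e\<close> whatever its middle argument is. Hence every two values
  of \<open>q\<close> are \<open>\<alpha>\<close>-related, and a \<open>\<beta>\<close>-step between them is an \<open>\<alpha> \<inter> \<beta>\<close>-step.
\<close>

lemma trancl_Un_image_Int:
  assumes "equiv A \<alpha>" "\<beta> \<subseteq> A \<times> A" "\<gamma> \<subseteq> A \<times> A"
    and \<alpha>: "\<And>u. u \<in> A \<Longrightarrow> (q u, e) \<in> \<alpha>"
    and \<beta>: "\<And>u v. (u, v) \<in> \<beta> \<Longrightarrow> (q u, q v) \<in> \<beta>"
    and \<gamma>: "\<And>u v. (u, v) \<in> \<gamma> \<Longrightarrow> (q u, q v) \<in> \<gamma>"
    and "(x, y) \<in> (\<beta> \<union> \<gamma>)\<^sup>+"
  shows "(q x, q y) \<in> (\<alpha> \<inter> \<beta> \<union> \<alpha> \<inter> \<gamma>)\<^sup>+"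
proof -
  have "(q u, q v) \<in> \<alpha>" if "u \<in> A" "v \<in> A" for u v
    using \<alpha>[OF that(1)] \<alpha>[OF that(2)] \<open>equiv A \<alpha>\<close>
    by (meson equivE symD transD)
  then have step: "(q u, q v) \<in> (\<alpha> \<inter> \<beta> \<union> \<alpha> \<inter> \<gamma>)\<^sup>+" if "(u, v) \<in> \<beta> \<union> \<gamma>" for u v
    using that assms(2,3) \<beta> \<gamma> by (intro r_into_trancl) blast
  from assms(7) show ?thesis
    by (induction rule: trancl_induct) (auto intro: step trancl_trans)
qed

text \<open>
  The operations \<open>m\<close> and \<open>j\<close> stand for term operations of the algebra \<open>(A, f)\<close>, and
  \<open>m_cong\<close>, \<open>j_cong\<close> express this semantically. The image of a chain from \<open>a\<close> to \<open>c\<close> under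
  \<open>\<lambda>u. m a (j c u)\<close> runs from \<open>m a (j c a) = a\<close> to \<open>m a (j c c) = m a c\<close>, and its image under
  \<open>\<lambda>u. m (j a u) c\<close> runs on from \<open>m (j a a) c = m a c\<close> to \<open>m (j a c) c = c\<close>.
\<close>

lemma congruence_distributive_if_absorption:
  assumes m_cong: "\<And>r x x' y y'. \<lbrakk>r \<in> congruences A f; (x, x') \<in> r; (y, y') \<in> r\<rbrakk>
      \<Longrightarrow> (m x y, m x' y') \<in> r"
    and j_cong: "\<And>r x x' y y'. \<lbrakk>r \<in> congruences A f; (x, x') \<in> r; (y, y') \<in> r\<rbrakk>
      \<Longrightarrow> (j x y, j x' y') \<in> r"
    and j_idem: "\<And>x. x \<in> A \<Longrightarrow> j x x = x"
    and absorb: "\<And>x y. \<lbrakk>x \<in> A; y \<in> A\<rbrakk> \<Longrightarrow> m x (j x y) = x"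
      "\<And>x y. \<lbrakk>x \<in> A; y \<in> A\<rbrakk> \<Longrightarrow> m x (j y x) = x"
      "\<And>x y. \<lbrakk>x \<in> A; y \<in> A\<rbrakk> \<Longrightarrow> m (j x y) x = x"
      "\<And>x y. \<lbrakk>x \<in> A; y \<in> A\<rbrakk> \<Longrightarrow> m (j y x) x = x"
  shows "congruence_distributive A f"
proof (rule congruence_distributiveI, rule subrelI)
  fix \<alpha> \<beta> \<gamma> a c
  assume C: "\<alpha> \<in> congruences A f" "\<beta> \<in> congruences A f" "\<gamma> \<in> congruences A f"
    and ac: "(a, c) \<in> \<alpha> \<inter> (\<beta> \<union> \<gamma>)\<^sup>+"
  let ?\<theta> = "(\<alpha> \<inter> \<beta> \<union> \<alpha> \<inter> \<gamma>)\<^sup>+"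
  note eq = C[THEN congruenceD(1)]
  have A: "a \<in> A" "c \<in> A"
    using ac eq(1) by (auto simp: equiv_def)
  have refl: "(u, u) \<in> r" if "r \<in> congruences A f" "u \<in> A" for r u
    using congruenceD(1)[OF that(1)] that(2) by (simp add: equiv_def refl_on_def)
  have ca: "(c, a) \<in> \<alpha>"
    using ac eq(1) by (auto simp: equiv_def dest: symD)
  have sub: "\<beta> \<subseteq> A \<times> A" "\<gamma> \<subseteq> A \<times> A"
    using eq by (auto simp: equiv_def)
  have "(m a (j c a), m a (j c c)) \<in> ?\<theta>"
  proof (rule trancl_Un_image_Int[where q = "\<lambda>u. m a (j c u)", OF eq(1) sub])
    show "(m a (j c u), a) \<in> \<alpha>" if "u \<in> A" for u
      using m_cong[OF C(1) refl j_cong, OF C(1) A(1) C(1) ca refl, OF C(1) that]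
      by (simp add: absorb A that)
  qed (use ac A C in \<open>auto intro!: m_cong j_cong refl\<close>)
  moreover have "(m (j a a) c, m (j a c) c) \<in> ?\<theta>"
  proof (rule trancl_Un_image_Int[where q = "\<lambda>u. m (j a u) c", OF eq(1) sub])
    show "(m (j a u) c, a) \<in> \<alpha>" if "u \<in> A" for u
      using m_cong[OF C(1) j_cong ca, OF C(1) refl refl, OF C(1) A(1) C(1) that]
      by (simp add: absorb A that)
  qed (use ac A C in \<open>auto intro!: m_cong j_cong refl\<close>)
  ultimately show "(a, c) \<in> ?\<theta>"
    by (simp add: absorb j_idem A)
qed

section \<open>Sheffer groupoids\<close>

text \<open>
  With the notation of the introduction, \<open>m x (j x y) = (x | (x' | y'))'\<close> and
  \<open>m (j x y) x = ((x' | y') | x)'\<close>. Hence the four absorption laws are the Sheffer identities and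
  their commuted forms with \<open>x', y'\<close> in place of \<open>x, y\<close>, followed by one application of \<open>'\<close>.
\<close>

theorem theorem4p5:
  fixes A :: "'a set" and op :: "'a \<Rightarrow> 'a \<Rightarrow> 'a" (infixl \<open>\<parallel>\<close> 70)
  assumes "sheffer_groupoid A op"
    and "\<And>x y. \<lbrakk>x \<in> A; y \<in> A\<rbrakk> \<Longrightarrow> (x \<parallel> y) \<parallel> (x \<parallel> x) = (x \<parallel> x) \<parallel> (x \<parallel> y)"
    and "\<And>x y. \<lbrakk>x \<in> A; y \<in> A\<rbrakk> \<Longrightarrow> (x \<parallel> y) \<parallel> (y \<parallel> y) = (y \<parallel> y) \<parallel> (x \<parallel> y)"
  shows "congruence_distributive A op"
proof -
  interpret sheffer_groupoid A op by (rule assms(1))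
  have dbl: "(x \<parallel> x) \<parallel> (x \<parallel> x) = x" if "x \<in> A" for x
    using sheffer_left that by blast
  have l: "(x \<parallel> x) \<parallel> (x \<parallel> y) = x" if "x \<in> A" "y \<in> A" for x y
    using sheffer_left assms(2) that by simp
  have r: "(y \<parallel> y) \<parallel> (x \<parallel> y) = y" if "x \<in> A" "y \<in> A" for x y
    using sheffer_right assms(3) that by simp
  show ?thesis
  proof (rule congruence_distributive_if_absorption
      [where m = "\<lambda>x y. (x \<parallel> y) \<parallel> (x \<parallel> y)" and j = "\<lambda>x y. (x \<parallel> x) \<parallel> (y \<parallel> y)"])
    fix x y assume A: "x \<in> A" "y \<in> A"
    then have A': "x \<parallel> x \<in> A" "y \<parallel> y \<in> A"
      by (simp_all add: closed)
    show "(x \<parallel> ((x \<parallel> x) \<parallel> (y \<parallel> y))) \<parallel> (x \<parallel> ((x \<parallel> x) \<parallel> (y \<parallel> y))) = x"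
      using l[OF A'] A by (simp add: dbl)
    show "(x \<parallel> ((y \<parallel> y) \<parallel> (x \<parallel> x))) \<parallel> (x \<parallel> ((y \<parallel> y) \<parallel> (x \<parallel> x))) = x"
      using r[OF A'(2,1)] A by (simp add: dbl)
    show "(((x \<parallel> x) \<parallel> (y \<parallel> y)) \<parallel> x) \<parallel> (((x \<parallel> x) \<parallel> (y \<parallel> y)) \<parallel> x) = x"
      using sheffer_left[OF A'] A by (simp add: dbl)
    show "(((y \<parallel> y) \<parallel> (x \<parallel> x)) \<parallel> x) \<parallel> (((y \<parallel> y) \<parallel> (x \<parallel> x)) \<parallel> x) = x"
      using sheffer_right[OF A'(2,1)] A by (simp add: dbl)
  qed (auto simp: dbl intro!: congruenceD(2)[where A = A and f = op])
qed

end
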